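(* Let $\mathcal P,\mathcal Q,\mathcal R,\mathcal P',\mathcal Q'$ be Euclidean sub-posets, and let $\mathsf{LDP}\{X,Y\}$ denote the set of linear design problems from $X$ to $Y$. Then: (a) (Series) For all $a\in\mathsf{LDP}\{\mathcal P,\mathcal Q\}$ and $b\in\mathsf{LDP}\{\mathcal Q,\mathcal R\}$, the series composition $\{\langle p,r\rangle\in\mathcal P\times\mathcal R \mid \exists q\in\mathcal Q:\ \langle p,q\rangle\in a,\ \langle q,r\rangle\in b\}$ is in $\mathsf{LDP}\{\mathcal P,\mathcal R\}$. (b) (Parallel) For all $a\in\mathsf{LDP}\{\mathcal P,\mathcal Q\}$ and $a'\in\mathsf{LDP}\{\mathcal P',\mathcal Q'\}$, the parallel composition $\{\langle\langle p,p'\rangle,\langle q,q'\rangle\rangle \mid \langle p,q\rangle\in a,\ \langle p',q'\rangle\in a'\}$ is in $\mathsf{LDP}\{\mathcal P\times\mathcal P',\mathcal Q\times\mathcal Q'\}$. (c) (Intersection) For all $a,b\in\mathsf{LDP}\{\mathcal P,\mathcal Q\}$, the intersection $\{\langle p,q\rangle\mid\langle p,q\rangle\in a,\ \langle p,q\rangle\in b\}$ is in $\mathsf{LDP}\{\mathcal P,\mathcal Q\}$. (d) (Feedback) For every $d\in\mathsf{LDP}\{\mathcal P\times\mathcal R,\mathcal Q\times\mathcal R\}$, the trace $\{\langle p,q\rangle\in\mathcal P\times\mathcal Q\mid\exists r\in\mathcal R:\ \langle\langle p,r\rangle,\langle q,r\rangle\rangle\in d\}$ is in $\mathsf{LDP}\{\mathcal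 P,\mathcal Q\}$.
   Context: A Euclidean sub-poset is a subset of some $\mathbb{R}^n_{\ge 0}$ with the restricted componentwise order $\preceq$; products of posets carry the componentwise order. For posets $F$ (functionalities) and $R$ (resources), a design problem (DP) from $F$ to $R$ is an upper set of $F^{\mathrm{op}}\times R$, where $F^{\mathrm{op}}$ is $F$ with reversed order: if $\langle x_F,x_R\rangle$ is in it, $x_F'\preceq x_F$ in $F$ and $x_R\preceq x_R'$ in $R$, then $\langle x_F',x_R'\rangle$ is in it. For Euclidean sub-posets $F\subseteq\mathbb{R}^{n_F}_{\ge0}$, $R\subseteq\mathbb{R}^{n_R}_{\ge0}$, a linear design problem (LDP) from $F$ to $R$ is a DP from $F$ to $R$ whose set of feasible pairs is a polyhedron (finite intersection of closed halfspaces $\{x:a^\top x\ge b\}$) in the underlying Euclidean space $\mathbb{R}^{n_F+n_R}$. *)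

theory Defs
  imports "HOL-Analysis.Analysis"
begin

(* The class ordered_euclidean_space has the componentwise order, and contains
   both real^'n and products such as (real^'n) \<times> (real^'m), the latter playing the
   role of R^(n+m).  These types have dimension at least 1; R^0 is represented by
   the singleton {0} in R^1. *)
definition euclidean_subposet :: "'a::ordered_euclidean_space set \<Rightarrow> bool" where
  "euclidean_subposet P \<longleftrightarrow> P \<subseteq> {x. 0 \<le> x}"

definition design_problem :: "'a::order set \<Rightarrow> 'b::order set \<Rightarrow> ('a \<times> 'b) set \<Rightarrow> bool" where
  "design_problem F R d \<longleftrightarrow>
     d \<subseteq> F \<times> R \<and>
     (\<forall>f r f' r'. (f, r) \<in> d \<longrightarrow> f' \<in> F \<longrightarrow> r' \<in> R \<longrightarrow> f' \<le> f \<longrightarrow> r \<le> r' \<longrightarrow> (f', r') \<in> d)"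

definition LDP ::
    "'a::ordered_euclidean_space set \<Rightarrow> 'b::ordered_euclidean_space set \<Rightarrow> ('a \<times> 'b) set set" where
  "LDP F R = {d. design_problem F R d \<and> polyhedron d}"

end

theory Submission
  imports Defs
begin

text \<open>
  Series composition and trace have the form \<open>{x. \<exists>y. f (x, y) \<in> D}\<close> with \<open>f\<close> linear and \<open>D\<close> a
  polyhedron, namely the product \<open>a \<times> b\<close> and \<open>d\<close> itself; parallel composition is the preimage of
  \<open>a \<times> a'\<close> under a permutation of coordinates. Every design
  problem confines its pairs to the posets, so \<open>D\<close> already expresses membership in them.
  What has to be known, besides closure under intersection, is that linear preimages and
  coordinate projections of polyhedra are polyhedra. Upper-set conditions are inherited: the
  internal variable that witnesses feasibility of a pair also witnesses it after the functionality
  is lowered and the resource is raised.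

  A preimage is easy: the adjoint of \<open>f\<close> moves each inequality to the domain. A projection is the
  substantial part, since a linear image of a closed set need not even be closed. It is handled by
  Fourier--Motzkin elimination: eliminating \<open>t\<close> from the inequalities that define
  \<open>x + t v \<in> S\<close> leaves finitely many inequalities in \<open>x\<close>, so the sum of \<open>S\<close> with the line through
  \<open>v\<close> is again a polyhedron (\<open>polyhedron_eliminate_direction\<close>). Iterating over a basis of a subspace
  adds the whole subspace to \<open>S\<close>, and the projection of \<open>S\<close> to the first factor of a product is the
  preimage, under \<open>x \<mapsto> (x, 0)\<close>, of the sum of \<open>S\<close> with the second factor. The elimination thus
  stays within one type, whatever number of coordinates is removed.
\<close>

section \<open>Polyhedra as systems of inequalities\<close>

lemma polyhedron_inequalities:
  fixes a :: "'i \<Rightarrow> 'a::euclidean_space"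
  assumes "finite I"
  shows "polyhedron {x. \<forall>i\<in>I. a i \<bullet> x \<le> b i}"
proof -
  have "{x. \<forall>i\<in>I. a i \<bullet> x \<le> b i} = \<Inter> ((\<lambda>i. {x. a i \<bullet> x \<le> b i}) ` I)"
    by auto
  then show ?thesis
    using assms polyhedron_halfspace_le by (auto intro!: polyhedron_Inter)
qed

lemma polyhedron_obtain_inequalities:
  fixes S :: "'a::euclidean_space set"
  assumes "polyhedron S"
  obtains I :: "('a \<times> real) set"
  where "finite I" "S = {x. \<forall>i\<in>I. fst i \<bullet> x \<le> snd i}"
proof -
  obtain F where F: "finite F" "S = \<Inter> F" "\<forall>h\<in>F. \<exists>a b. a \<noteq> 0 \<and> h = {x. a \<bullet> x \<le> b}"
    using assms unfolding polyhedron_def by blast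
  then have "\<forall>h\<in>F. \<exists>i. h = {x. fst i \<bullet> x \<le> snd i}"
    by (metis fst_conv snd_conv)
  then obtain g where g: "\<And>h. h \<in> F \<Longrightarrow> h = {x. fst (g h) \<bullet> x \<le> snd (g h)}"
    by metis
  have "S = {x. \<forall>i\<in>g ` F. fst i \<bullet> x \<le> snd i}"
    using F(2) g by blast
  with F(1) show thesis
    by (intro that[of "g ` F"]) auto
qed

lemma polyhedron_linear_vimage:
  fixes f :: "'a::euclidean_space \<Rightarrow> 'b::euclidean_space"
  assumes "linear f" "polyhedron S"
  shows "polyhedron (f -` S)"
proof -
  obtain I where I: "finite I" "S = {x. \<forall>i\<in>I. fst i \<bullet> x \<le> snd i}"
    using polyhedron_obtain_inequalities[OF assms(2)] .
  (* the adjoint may send a nonzero normal to 0, which the inequality form of a polyhedron admits *)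
  have "f -` S = {x. \<forall>i\<in>I. adjoint f (fst i) \<bullet> x \<le> snd i}"
    unfolding I(2) by (auto simp: adjoint_works[OF assms(1)] inner_commute)
  then show ?thesis
    using polyhedron_inequalities[OF I(1)] by simp
qed

lemma polyhedron_Times:
  fixes S :: "'a::euclidean_space set" and T :: "'b::euclidean_space set"
  assumes "polyhedron S" "polyhedron T"
  shows "polyhedron (S \<times> T)"
proof -
  have "S \<times> T = fst -` S \<inter> snd -` T"
    by auto
  then show ?thesis
    using assms by (simp add: polyhedron_linear_vimage linear_fst linear_snd polyhedron_Int)
qed

section \<open>Fourier--Motzkin elimination\<close>

lemma ex_between_finite_sets:
  fixes L U :: "real set"
  assumes "finite L" "finite U" and le: "\<And>l u. l \<in> L \<Longrightarrow> u \<in> U \<Longrightarrow> l \<le> u"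
  shows "\<exists>t. (\<forall>l\<in>L. l \<le> t) \<and> (\<forall>u\<in>U. t \<le> u)"
proof (cases "L = {}")
  case True
  show ?thesis
  proof (cases "U = {}")
    case False
    with True \<open>finite U\<close> show ?thesis by (intro exI[of _ "Min U"]) auto
  qed (use True in auto)
next
  case False
  with assms show ?thesis by (intro exI[of _ "Max L"]) auto
qed

text \<open>
  The sign of \<open>c i\<close> decides what an inequality says about \<open>t\<close>: nothing, an upper bound, or a lower
  bound. A common solution exists iff every lower bound is at most every upper bound; written
  without division, this comparison is the positive combination of the two inequalities in which
  \<open>t\<close> cancels.
\<close>
lemma ex_solution_iff_eliminated:
  fixes c d :: "'i \<Rightarrow> real"
  assumes "finite I"
  shows "(\<exists>t. \<forall>i\<in>I. t * c i \<le> d i) \<longleftrightarrow>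
    (\<forall>i\<in>{i\<in>I. c i = 0}. 0 \<le> d i) \<and>
    (\<forall>(i, j)\<in>{i\<in>I. c i > 0} \<times> {j\<in>I. c j < 0}. 0 \<le> c i * d j - c j * d i)"
    (is "?L \<longleftrightarrow> ?Z \<and> ?C")
proof
  assume ?L
  then obtain t where t: "\<And>i. i \<in> I \<Longrightarrow> t * c i \<le> d i"
    by blast
  have "0 \<le> c i * d j - c j * d i" if "i \<in> I" "c i > 0" "j \<in> I" "c j < 0" for i j
  proof -
    have "c i * (t * c j) \<le> c i * d j" "c j * d i \<le> c j * (t * c i)"
      using that t[of i] t[of j] by (auto intro: mult_left_mono mult_left_mono_neg)
    then show ?thesis
      by (simp add: algebra_simps)
  qed
  then show "?Z \<and> ?C"
    using t by fastforce
next
  assume R: "?Z \<and> ?C"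
  define L where "L = (\<lambda>j. d j / c j) ` {j\<in>I. c j < 0}"
  define U where "U = (\<lambda>i. d i / c i) ` {i\<in>I. c i > 0}"
  have "l \<le> u" if "l \<in> L" "u \<in> U" for l u
  proof -
    obtain i where i: "i \<in> I" "c i > 0" "u = d i / c i"
      using \<open>u \<in> U\<close> unfolding U_def by auto
    obtain j where j: "j \<in> I" "c j < 0" "l = d j / c j"
      using \<open>l \<in> L\<close> unfolding L_def by auto
    from i j have "0 \<le> c i * d j - c j * d i"
      using R by auto
    also have "c i * d j - c j * d i = (c i * c j) * (l - u)"
      using i j by (simp add: field_simps)
    finally show ?thesis
      using mult_pos_neg[OF i(2) j(2)] by (simp add: zero_le_mult_iff[of "c i * c j"])
  qed
  moreover have "finite L" "finite U"
    using assms unfolding L_def U_def by auto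
  ultimately obtain t where t: "\<And>l. l \<in> L \<Longrightarrow> l \<le> t" "\<And>u. u \<in> U \<Longrightarrow> t \<le> u"
    using ex_between_finite_sets by metis
  have "t * c i \<le> d i" if "i \<in> I" for i
  proof (cases "c i" "0::real" rule: linorder_cases)
    case less
    with that have "d i / c i \<le> t"
      by (intro t(1)) (auto simp: L_def)
    with less show ?thesis
      by (simp add: neg_divide_le_eq)
  next
    case equal
    with that R show ?thesis
      by auto
  next
    case greater
    with that have "t \<le> d i / c i"
      by (intro t(2)) (auto simp: U_def)
    with greater show ?thesis
      by (simp add: pos_le_divide_eq)
  qed
  then show ?L
    by blast
qed

text \<open>
  For fixed \<open>x\<close> the condition is a system of inequalities in the single unknown \<open>t\<close>, whose right-hand
  sides are affine in \<open>x\<close>; the eliminated system is therefore again one of affine inequalities in \<open>x\<close>.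
\<close>
lemma polyhedron_eliminate_direction:
  fixes S :: "'a::euclidean_space set" and v :: 'a
  assumes "polyhedron S"
  shows "polyhedron {x. \<exists>t. x + t *\<^sub>R v \<in> S}"
proof -
  obtain I where I: "finite I" "S = {x. \<forall>i\<in>I. fst i \<bullet> x \<le> snd i}"
    using polyhedron_obtain_inequalities[OF assms] .
  define c where "c i = fst i \<bullet> v" for i :: "'a \<times> real"
  define Z where "Z = {i\<in>I. c i = 0}"
  define C where "C = {i\<in>I. c i > 0} \<times> {j\<in>I. c j < 0}"
  have "(\<exists>t. x + t *\<^sub>R v \<in> S) \<longleftrightarrow>
      (\<forall>i\<in>Z. fst i \<bullet> x \<le> snd i) \<and>
      (\<forall>p\<in>C. (c (fst p) *\<^sub>R fst (snd p) - c (snd p) *\<^sub>R fst (fst p)) \<bullet> x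
        \<le> c (fst p) * snd (snd p) - c (snd p) * snd (fst p))" for x
  proof -
    have "(\<exists>t. x + t *\<^sub>R v \<in> S) \<longleftrightarrow> (\<exists>t. \<forall>i\<in>I. t * c i \<le> snd i - fst i \<bullet> x)"
      unfolding I(2) c_def by (simp add: inner_add_right algebra_simps)
    also have "\<dots> \<longleftrightarrow> (\<forall>i\<in>Z. 0 \<le> snd i - fst i \<bullet> x) \<and>
        (\<forall>(i, j)\<in>C. 0 \<le> c i * (snd j - fst j \<bullet> x) - c j * (snd i - fst i \<bullet> x))"
      unfolding Z_def C_def by (rule ex_solution_iff_eliminated[OF I(1)])
    finally show ?thesis
      by (simp add: case_prod_beta inner_diff_left algebra_simps)
  qed
  then have "{x. \<exists>t. x + t *\<^sub>R v \<in> S} =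
      {x. \<forall>i\<in>Z. fst i \<bullet> x \<le> snd i} \<inter>
      {x. \<forall>p\<in>C. (c (fst p) *\<^sub>R fst (snd p) - c (snd p) *\<^sub>R fst (fst p)) \<bullet> x
        \<le> c (fst p) * snd (snd p) - c (snd p) * snd (fst p)}"
    by blast
  moreover have "finite Z" "finite C"
    using I(1) unfolding Z_def C_def by auto
  ultimately show ?thesis
    by (simp add: polyhedron_Int polyhedron_inequalities)
qed

lemma polyhedron_eliminate_span:
  fixes S B :: "'a::euclidean_space set"
  assumes "finite B" "polyhedron S"
  shows "polyhedron {x. \<exists>y\<in>span B. x + y \<in> S}"
  using assms(1)
proof (induction B)
  case empty
  then show ?case
    using assms(2) by simp
next
  case (insert v B)
  (* adding span (insert v B) to S is adding span B first and then the line through v *)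
  have "(\<exists>y\<in>span (insert v B). x + y \<in> S) \<longleftrightarrow> (\<exists>t. \<exists>y\<in>span B. x + t *\<^sub>R v + y \<in> S)" for x
  proof
    assume "\<exists>y\<in>span (insert v B). x + y \<in> S"
    then obtain y t where "x + y \<in> S" "y - t *\<^sub>R v \<in> span B"
      by (auto simp: span_insert)
    then show "\<exists>t. \<exists>y\<in>span B. x + t *\<^sub>R v + y \<in> S"
      by (intro exI[of _ t] bexI[of _ "y - t *\<^sub>R v"]) auto
  next
    assume "\<exists>t. \<exists>y\<in>span B. x + t *\<^sub>R v + y \<in> S"
    then obtain t y where "y \<in> span B" "x + t *\<^sub>R v + y \<in> S"
      by blast
    then show "\<exists>y\<in>span (insert v B). x + y \<in> S"
      by (intro bexI[of _ "t *\<^sub>R v + y"]) (auto simp: span_insert add.assoc intro!: exI[of _ t])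
  qed
  then show ?case
    using polyhedron_eliminate_direction[OF insert.IH, of v] by simp
qed

text \<open>
  Hiding \<open>y\<close> means that \<open>(x, 0)\<close> may be moved into \<open>S\<close> along the subspace \<open>{0} \<times> UNIV\<close>, which is
  spanned by finitely many vectors.
\<close>
lemma polyhedron_projection:
  fixes S :: "('a::euclidean_space \<times> 'b::euclidean_space) set"
  assumes "polyhedron S"
  shows "polyhedron {x. \<exists>y. (x, y) \<in> S}"
proof -
  define B :: "('a \<times> 'b) set" where "B = Pair 0 ` Basis"
  have lin: "linear (Pair (0::'a) :: 'b \<Rightarrow> _)" "linear (\<lambda>x::'a. (x, 0::'b))"
    by (auto intro!: linearI)
  have "span B = range (Pair 0)"
    unfolding B_def by (simp add: span_linear_image[OF lin(1)])
  then have eq: "{x. \<exists>y. (x, y) \<in> S} = (\<lambda>x. (x, 0)) -` {z. \<exists>w\<in>span B. z + w \<in> S}"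
    by auto
  have "finite B"
    unfolding B_def by simp
  then show ?thesis
    unfolding eq by (intro polyhedron_linear_vimage lin(2) polyhedron_eliminate_span assms)
qed

section \<open>Compositions of linear design problems\<close>

text \<open>
  The map \<open>f\<close> wires the external variables \<open>x\<close> and the internal variable \<open>y\<close> to the ports of \<open>D\<close>,
  possibly using \<open>y\<close> at two ports; the quantifier then hides \<open>y\<close>.
\<close>
lemma polyhedron_ex_linear:
  fixes f :: "'a::euclidean_space \<times> 'b::euclidean_space \<Rightarrow> 'c::euclidean_space"
  assumes "linear f" "polyhedron D"
  shows "polyhedron {x. \<exists>y. f (x, y) \<in> D}"
  using polyhedron_projection[OF polyhedron_linear_vimage[OF assms]] by simp

lemma LDP_series:
  assumes a: "a \<in> LDP P Q" and b: "b \<in> LDP Q R"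
  shows "{(p, r). p \<in> P \<and> r \<in> R \<and> (\<exists>q\<in>Q. (p, q) \<in> a \<and> (q, r) \<in> b)} \<in> LDP P R"
    (is "?S \<in> _")
proof -
  have da: "design_problem P Q a" and db: "design_problem Q R b"
    and poly: "polyhedron (a \<times> b)"
    using a b by (auto simp: LDP_def polyhedron_Times)
  (* pairs of a lie in P \<times> Q and pairs of b in Q \<times> R, so the bounds on p, q, r can be dropped *)
  have "?S = {x. \<exists>q. ((fst x, q), (q, snd x)) \<in> a \<times> b}"
    using da db by (auto simp: design_problem_def)
  moreover have "linear (\<lambda>z. ((fst (fst z), snd z), (snd z, snd (fst z))))"
    by (auto intro!: linearI)
  ultimately have "polyhedron ?S"
    using polyhedron_ex_linear[OF _ poly] by fastforce
  moreover have "design_problem P R ?S"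
    unfolding design_problem_def
  proof (intro conjI allI impI)
    fix p r p' r'
    assume "(p, r) \<in> ?S" and new: "p' \<in> P" "r' \<in> R" "p' \<le> p" "r \<le> r'"
    then obtain q where q: "q \<in> Q" "(p, q) \<in> a" "(q, r) \<in> b"
      by auto
    have "(p', q) \<in> a"
      using da q new unfolding design_problem_def by blast
    moreover have "(q, r') \<in> b"
      using db q new unfolding design_problem_def by blast
    ultimately show "(p', r') \<in> ?S"
      using q new by auto
  qed auto
  ultimately show ?thesis
    by (simp add: LDP_def)
qed

lemma LDP_parallel:
  assumes a: "a \<in> LDP P Q" and a': "a' \<in> LDP P' Q'"
  shows "{((p, p'), (q, q')) | p p' q q'. (p, q) \<in> a \<and> (p', q') \<in> a'}
    \<in> LDP (P \<times> P') (Q \<times> Q')"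
    (is "?S \<in> _")
proof -
  have da: "design_problem P Q a" and da': "design_problem P' Q' a'"
    and poly: "polyhedron (a \<times> a')"
    using a a' by (auto simp: LDP_def polyhedron_Times)
  let ?f = "\<lambda>z. ((fst (fst z), fst (snd z)), (snd (fst z), snd (snd z)))"
  have "?S = ?f -` (a \<times> a')"
    by force
  moreover have "linear ?f"
    by (auto intro!: linearI)
  ultimately have "polyhedron ?S"
    using polyhedron_linear_vimage[OF _ poly, of ?f] by simp
  moreover have "design_problem (P \<times> P') (Q \<times> Q') ?S"
    unfolding design_problem_def
  proof (intro conjI allI impI)
    show "?S \<subseteq> (P \<times> P') \<times> (Q \<times> Q')"
      using da da' unfolding design_problem_def by blast
  next
    fix x y x' y'
    assume "(x, y) \<in> ?S" and new: "x' \<in> P \<times> P'" "y' \<in> Q \<times> Q'" "x' \<le> x" "y \<le> y'"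
    then have old: "(fst x, fst y) \<in> a" "(snd x, snd y) \<in> a'"
      by auto
    have "(fst x', fst y') \<in> a"
      using da old(1) new unfolding design_problem_def less_eq_prod_def mem_Times_iff by blast
    moreover have "(snd x', snd y') \<in> a'"
      using da' old(2) new unfolding design_problem_def less_eq_prod_def mem_Times_iff by blast
    ultimately show "(x', y') \<in> ?S"
      by (cases x', cases y') auto
  qed
  ultimately show ?thesis
    by (simp add: LDP_def)
qed

lemma LDP_Int:
  assumes "a \<in> LDP P Q" "b \<in> LDP P Q"
  shows "a \<inter> b \<in> LDP P Q"
proof -
  have "polyhedron (a \<inter> b)"
    using assms by (simp add: LDP_def polyhedron_Int)
  moreover have "design_problem P Q (a \<inter> b)"
    using assms unfolding LDP_def design_problem_def by blast
  ultimately show ?thesis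
    by (simp add: LDP_def)
qed

lemma LDP_trace:
  assumes d: "d \<in> LDP (P \<times> R) (Q \<times> R)"
  shows "{(p, q). p \<in> P \<and> q \<in> Q \<and> (\<exists>r\<in>R. ((p, r), (q, r)) \<in> d)} \<in> LDP P Q"
    (is "?S \<in> _")
proof -
  have dd: "design_problem (P \<times> R) (Q \<times> R) d" and poly: "polyhedron d"
    using d by (auto simp: LDP_def)
  (* pairs of d lie in (P \<times> R) \<times> (Q \<times> R), so the bounds on p, q, r can be dropped *)
  have "?S = {x. \<exists>r. ((fst x, r), (snd x, r)) \<in> d}"
    using dd by (auto simp: design_problem_def)
  moreover have "linear (\<lambda>z. ((fst (fst z), snd z), (snd (fst z), snd z)))"
    by (auto intro!: linearI)
  ultimately have "polyhedron ?S"
    using polyhedron_ex_linear[OF _ poly] by fastforce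
  moreover have "design_problem P Q ?S"
    unfolding design_problem_def
  proof (intro conjI allI impI)
    fix p q p' q'
    assume "(p, q) \<in> ?S" and new: "p' \<in> P" "q' \<in> Q" "p' \<le> p" "q \<le> q'"
    then obtain r where r: "r \<in> R" "((p, r), (q, r)) \<in> d"
      by auto
    moreover have "(p', r) \<le> (p, r)" "(q, r) \<le> (q', r)"
      using new by (auto simp: less_eq_prod_def)
    ultimately have "((p', r), (q', r)) \<in> d"
      using dd new unfolding design_problem_def by blast
    then show "(p', q') \<in> ?S"
      using r new by auto
  qed auto
  ultimately show ?thesis
    by (simp add: LDP_def)
qed

theorem lemma2:
  fixes P :: "(real ^ 'p) set" and Q :: "(real ^ 'q) set" and R :: "(real ^ 'r) set"
    and P' :: "(real ^ 'p2) set" and Q' :: "(real ^ 'q2) set"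
  assumes "euclidean_subposet P" and "euclidean_subposet Q" and "euclidean_subposet R"
    and "euclidean_subposet P'" and "euclidean_subposet Q'"
  shows
    "(\<forall>a \<in> LDP P Q. \<forall>b \<in> LDP Q R.
        {(p, r). p \<in> P \<and> r \<in> R \<and> (\<exists>q\<in>Q. (p, q) \<in> a \<and> (q, r) \<in> b)} \<in> LDP P R)
   \<and> (\<forall>a \<in> LDP P Q. \<forall>a' \<in> LDP P' Q'.
        {((p, p'), (q, q')) | p p' q q'. (p, q) \<in> a \<and> (p', q') \<in> a'} \<in> LDP (P \<times> P') (Q \<times> Q'))
   \<and> (\<forall>a \<in> LDP P Q. \<forall>b \<in> LDP P Q.
        {(p, q). (p, q) \<in> a \<and> (p, q) \<in> b} \<in> LDP P Q)
   \<and> (\<forall>d \<in> LDP (P \<times> R) (Q \<times> R).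
        {(p, q). p \<in> P \<and> q \<in> Q \<and> (\<exists>r\<in>R. ((p, r), (q, r)) \<in> d)} \<in> LDP P Q)"
proof (intro conjI ballI)
  fix a b
  assume "a \<in> LDP P Q" "b \<in> LDP Q R"
  then show "{(p, r). p \<in> P \<and> r \<in> R \<and> (\<exists>q\<in>Q. (p, q) \<in> a \<and> (q, r) \<in> b)} \<in> LDP P R"
    by (rule LDP_series)
next
  fix a a'
  assume "a \<in> LDP P Q" "a' \<in> LDP P' Q'"
  then show "{((p, p'), (q, q')) | p p' q q'. (p, q) \<in> a \<and> (p', q') \<in> a'}
      \<in> LDP (P \<times> P') (Q \<times> Q')"
    by (rule LDP_parallel)
next
  fix a b
  assume "a \<in> LDP P Q" "b \<in> LDP P Q"
  moreover have "{(p, q). (p, q) \<in> a \<and> (p, q) \<in> b} = a \<inter> b"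
    by auto
  ultimately show "{(p, q). (p, q) \<in> a \<and> (p, q) \<in> b} \<in> LDP P Q"
    by (simp add: LDP_Int)
next
  fix d
  assume "d \<in> LDP (P \<times> R) (Q \<times> R)"
  then show "{(p, q). p \<in> P \<and> q \<in> Q \<and> (\<exists>r\<in>R. ((p, r), (q, r)) \<in> d)} \<in> LDP P Q"
    by (rule LDP_trace)
qed

end
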